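(* Let $a>0$, $V_1=(0,0)$, $V_2=(0,a)$ and $P(t)=a(\cos t,\sin t)$, $t\in[0,2\pi)$. Let $\Omega_1(t)$ and $\Omega_2(t)$ be the Brocard points of the triangle $V_1V_2P(t)$. Then, as $t$ ranges over $[0,2\pi)$, the locus of $\Omega_1$ is a circle of radius $\frac{a}{3}$, enclosing area $\frac{\pi a^2}{9}$, and the locus of $\Omega_2$ is a (teardrop-shaped) closed curve enclosing area $\frac{2\pi a^2}{9}$.
   Context: Brocard points: for the triangle $V_1V_2P$, $\Omega_1$ is the unique interior point with $\angle \Omega_1V_1V_2=\angle\Omega_1V_2P=\angle\Omega_1PV_1$, and $\Omega_2$ is the unique interior point with $\angle\Omega_2V_2V_1=\angle\Omega_2PV_2=\angle\Omega_2V_1P$. The common angle (the same for both points) is the Brocard angle. The assignment of names $\Omega_1,\Omega_2$ is by the vertex labels and is kept fixed as $P(t)$ moves. At the finitely many values of $t$ for which the triangle is degenerate, the Brocard points are understood as limits, so that the locus is a closed curve. "Teardrop" is a descriptive term for the shape of the curve (a closed curve with one pointed end). The area enclosed by a closed curve is the absolute value of $\frac12\oint (x\,dy-y\,dx)$, taken over one revolution of $t$. *)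

theory Defs
  imports "HOL-Analysis.Analysis"
begin

text \<open>
  The Euclidean plane is \<^typ>\<open>real \<times> real\<close>, whose library norm and inner product are the
  Euclidean ones.
\<close>

type_synonym point = "real \<times> real"

text \<open>Unoriented angle at the vertex \<open>B\<close>, in \<open>[0, pi]\<close>.\<close>

definition angle :: "point \<Rightarrow> point \<Rightarrow> point \<Rightarrow> real" where
  "angle A B C = arccos (((A - B) \<bullet> (C - B)) / (norm (A - B) * norm (C - B)))"

definition brocard1 :: "point \<Rightarrow> point \<Rightarrow> point \<Rightarrow> point" where
  "brocard1 A B C = (THE X. X \<in> interior (convex hull {A, B, C}) \<and>
     angle X A B = angle X B C \<and> angle X B C = angle X C A)"

definition brocard2 :: "point \<Rightarrow> point \<Rightarrow> point \<Rightarrow> point" where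
  "brocard2 A B C = (THE X. X \<in> interior (convex hull {A, B, C}) \<and>
     angle X B A = angle X C B \<and> angle X C B = angle X A C)"

definition V1 :: point where
  "V1 = (0, 0)"

definition V2 :: "real \<Rightarrow> point" where
  "V2 a = (0, a)"

definition P :: "real \<Rightarrow> real \<Rightarrow> point" where
  "P a t = a *\<^sub>R (cos t, sin t)"

text \<open>
  The moving Brocard points. They are defined for all real \<open>t\<close>, with period \<open>2 * pi\<close>, so that
  two-sided limits and derivatives make sense at every \<open>t\<close> in \<open>[0, 2 * pi)\<close>. Where the triangle
  degenerates, the value is the limit; \<^const>\<open>collinear\<close> includes the case of coinciding vertices.
\<close>

definition Omega1 :: "real \<Rightarrow> real \<Rightarrow> point" where
  "Omega1 a t = (if collinear {V1, V2 a, P a t}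
     then Lim (at t) (\<lambda>s. brocard1 V1 (V2 a) (P a s))
     else brocard1 V1 (V2 a) (P a t))"

definition Omega2 :: "real \<Rightarrow> real \<Rightarrow> point" where
  "Omega2 a t = (if collinear {V1, V2 a, P a t}
     then Lim (at t) (\<lambda>s. brocard2 V1 (V2 a) (P a s))
     else brocard2 V1 (V2 a) (P a t))"

text \<open>One revolution of the parameter, as a path on the unit interval.\<close>

definition revolution :: "(real \<Rightarrow> point) \<Rightarrow> real \<Rightarrow> point" where
  "revolution \<gamma> = (\<lambda>u. \<gamma> (2 * pi * u))"

text \<open>Piecewise \<open>C\<^sup>1\<close>, so that line integrals along the curve make sense.\<close>

definition closed_curve :: "(real \<Rightarrow> point) \<Rightarrow> bool" where
  "closed_curve \<gamma> \<longleftrightarrow>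
     valid_path (revolution \<gamma>) \<and> pathfinish (revolution \<gamma>) = pathstart (revolution \<gamma>)"

text \<open>The closed curve \<open>\<gamma>\<close> encloses the area given by half the integral of \<open>x dy - y dx\<close>.\<close>

definition encloses_area :: "(real \<Rightarrow> point) \<Rightarrow> real \<Rightarrow> bool" where
  "encloses_area \<gamma> A \<longleftrightarrow> closed_curve \<gamma> \<and>
     (\<exists>I. ((\<lambda>t. fst (\<gamma> t) * snd (vector_derivative \<gamma> (at t))
              - snd (\<gamma> t) * fst (vector_derivative \<gamma> (at t))) has_integral I) {0..2 * pi} \<and>
          A = \<bar>I / 2\<bar>)"

text \<open>
  \<open>u\<close> is the unit direction in which the curve leaves the point at parameter \<open>t\<close>, \<open>v\<close> the one in
  which it arrives there. Both refer to the direction of travel, so they agree at a smooth point and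
  differ at a corner or a cusp (\<open>v = - u\<close>).
\<close>

definition tangent_directions :: "(real \<Rightarrow> point) \<Rightarrow> real \<Rightarrow> point \<Rightarrow> point \<Rightarrow> bool" where
  "tangent_directions \<gamma> t u v \<longleftrightarrow>
     ((\<lambda>s. sgn (\<gamma> s - \<gamma> t)) \<longlongrightarrow> u) (at_right t) \<and>
     ((\<lambda>s. sgn (\<gamma> t - \<gamma> s)) \<longlongrightarrow> v) (at_left t)"

definition pointed_at :: "(real \<Rightarrow> point) \<Rightarrow> real \<Rightarrow> bool" where
  "pointed_at \<gamma> t \<longleftrightarrow> (\<exists>u v. tangent_directions \<gamma> t u v \<and> u \<noteq> v)"

definition smooth_at :: "(real \<Rightarrow> point) \<Rightarrow> real \<Rightarrow> bool" where
  "smooth_at \<gamma> t \<longleftrightarrow> (\<exists>u. tangent_directions \<gamma> t u u)"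

text \<open>
  A closed curve without self-intersections and with exactly one pointed end; intended for
  \<open>2 * pi\<close>-periodic \<open>\<gamma>\<close>.
\<close>

definition teardrop :: "(real \<Rightarrow> point) \<Rightarrow> bool" where
  "teardrop \<gamma> \<longleftrightarrow> closed_curve \<gamma> \<and> simple_path (revolution \<gamma>) \<and>
     (\<exists>t\<^sub>0\<in>{0..<2 * pi}. pointed_at \<gamma> t\<^sub>0 \<and> (\<forall>t\<in>{0..<2 * pi} - {t\<^sub>0}. smooth_at \<gamma> t))"

end

theory Submission
  imports Defs
begin

text \<open>
  The triangle \<open>V\<^sub>1 V\<^sub>2 P(t)\<close> is isosceles with legs \<open>a\<close> at \<open>V\<^sub>1\<close>, and its third side has square
  \<open>d a\<^sup>2\<close> with \<open>d = 2 (1 - sin t)\<close>. In barycentric coordinates with respect to a triangle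
  \<open>A B C\<close> whose opposite sides have squares \<open>\<alpha>, \<beta>, \<gamma>\<close> the Brocard points are
  \<open>1/\<beta> : 1/\<gamma> : 1/\<alpha>\<close> and \<open>1/\<gamma> : 1/\<alpha> : 1/\<beta>\<close>, so here they are
  \<open>d : d : 1\<close> and \<open>d : 1 : d\<close>. Both become rational functions of \<open>cos t\<close> and \<open>sin t\<close> with the
  denominator \<open>2 d + 1 = 5 - 4 sin t\<close>, which never vanishes; these formulas therefore also give the
  limits at the two degenerate positions (lemmas \<open>Omega1_eq\<close> and \<open>Omega2_eq\<close>).

  To see that the Brocard coordinates are right and unique (\<open>brocard1_eqI\<close>), each of the three angles
  is expressed through its cotangent. Writing \<open>x, y, z\<close> for the coordinates of an interior point, the
  cotangents agree precisely if
  \<open>\<gamma> y/z - \<alpha> = \<alpha> z/x - \<beta> = \<beta> x/y - \<gamma>\<close>. If \<open>k\<close> is the common value, multiplying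
  the three equations gives \<open>(\<alpha> + k) (\<beta> + k) (\<gamma> + k) = \<alpha> \<beta> \<gamma>\<close> with positive factors on the left,
  so \<open>k = 0\<close> by monotonicity, and the ratios \<open>x : y : z\<close> are determined.

  From the explicit curves everything is calculus. The first satisfies the equation of a circle,
  and it covers the whole circle because suitable \<open>(cos t, sin t)\<close> can be computed rationally from any
  point of it. For the second, the ordinate is a
  strictly increasing function of \<open>sin t\<close> with nonvanishing derivative. This gives simplicity, and a
  nonzero vertical velocity except where \<open>cos t = 0\<close>; at \<open>sin t = - 1\<close> the horizontal velocity does not
  vanish. At \<open>sin t = 1\<close> the displacement from the tip is a positive multiple of
  \<open>(cos t, sin t - 2)\<close>, so the curve arrives and leaves along the same ray. Both area
  integrands are combinations of \<open>1 / (5 - 4 sin t)\<close> and the derivative of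
  \<open>cos t / (5 - 4 sin t)\<close>; only the former, a multiple of the Poisson kernel, contributes.
\<close>

section \<open>Angles and barycentric coordinates\<close>

definition cross2 :: "point \<Rightarrow> point \<Rightarrow> real" where
  "cross2 u v = fst u * snd v - snd u * fst v"

lemma inner_cross2_identity:
  "(u \<bullet> v)\<^sup>2 + (cross2 u v)\<^sup>2 = (norm u)\<^sup>2 * (norm v)\<^sup>2"
  unfolding cross2_def power2_norm_eq_inner inner_prod_def
  by (simp add: power2_eq_square algebra_simps)

text \<open>Collinearity is the equality case of Cauchy--Schwarz.\<close>

lemma collinear_iff_cross2:
  fixes A B C :: point
  shows "collinear {A, B, C} \<longleftrightarrow> cross2 (B - A) (C - A) = 0"
proof -
  have "collinear {A, B, C} \<longleftrightarrow> collinear {0, B - A, C - A}"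
    using collinear_3[of B A C] by (simp add: insert_commute)
  also have "\<dots> \<longleftrightarrow> \<bar>(B - A) \<bullet> (C - A)\<bar> = norm (B - A) * norm (C - A)"
    by (rule norm_cauchy_schwarz_equal[symmetric])
  also have "\<dots> \<longleftrightarrow> ((B - A) \<bullet> (C - A))\<^sup>2 = (norm (B - A) * norm (C - A))\<^sup>2"
    by (metis abs_mult abs_norm_cancel power2_abs power2_eq_iff_nonneg abs_ge_zero)
  also have "\<dots> \<longleftrightarrow> cross2 (B - A) (C - A) = 0"
    using inner_cross2_identity[of "B - A" "C - A"]
    unfolding power_mult_distrib by (smt (verit) zero_eq_power2)
  finally show ?thesis .
qed

text \<open>
  Passing to the cotangent linearises the angle conditions, and \<open>arctan\<close>, being injective on all of
  the reals, makes equality of angles equivalent to equality of cotangents.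
\<close>

lemma angle_eq_arctan:
  assumes "cross2 (A - B) (C - B) \<noteq> 0"
  shows "angle A B C = pi / 2 - arctan (((A - B) \<bullet> (C - B)) / \<bar>cross2 (A - B) (C - B)\<bar>)"
proof -
  define D where "D = (A - B) \<bullet> (C - B)"
  define N where "N = \<bar>cross2 (A - B) (C - B)\<bar>"
  have N: "N > 0" using assms by (simp add: N_def)
  have "norm (A - B) * norm (C - B) = sqrt (D\<^sup>2 + N\<^sup>2)"
    using inner_cross2_identity[of "A - B" "C - B"]
    by (simp add: D_def N_def real_sqrt_mult)
  also have "D\<^sup>2 + N\<^sup>2 = N\<^sup>2 * (1 + (D / N)\<^sup>2)"
    using N by (simp add: field_simps)
  also have "sqrt \<dots> = N * sqrt (1 + (D / N)\<^sup>2)"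
    using N by (simp add: real_sqrt_mult)
  finally have "D / (norm (A - B) * norm (C - B)) = sin (arctan (D / N))"
    by (simp add: sin_arctan)
  also have "\<dots> = cos (pi / 2 - arctan (D / N))"
    by (simp add: sin_cos_eq)
  finally have *: "angle A B C = arccos (cos (pi / 2 - arctan (D / N)))"
    by (simp add: angle_def D_def)
  show ?thesis
    unfolding * D_def[symmetric] N_def[symmetric]
    using arctan_bounded[of "D / N"] by (intro arccos_cos) auto
qed

lemma angle_in_barycentric:
  assumes "x + y + z = 1" "z > 0" and K: "cross2 (B - A) (C - A) \<noteq> 0"
  shows "angle (x *\<^sub>R A + y *\<^sub>R B + z *\<^sub>R C) A B =
    pi / 2 - arctan ((y / z * (norm (B - A))\<^sup>2 + (B - A) \<bullet> (C - A)) / \<bar>cross2 (B - A) (C - A)\<bar>)"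
proof -
  define u v where "u = B - A" and "v = C - A"
  have x: "x = 1 - y - z" using assms by simp
  have X: "x *\<^sub>R A + y *\<^sub>R B + z *\<^sub>R C - A = y *\<^sub>R u + z *\<^sub>R v"
    by (simp add: x u_def v_def algebra_simps)
  have cr: "cross2 (y *\<^sub>R u + z *\<^sub>R v) u = - z * cross2 u v"
    by (simp add: cross2_def algebra_simps)
  have "angle (x *\<^sub>R A + y *\<^sub>R B + z *\<^sub>R C) A B =
    pi / 2 - arctan (((y *\<^sub>R u + z *\<^sub>R v) \<bullet> u) / \<bar>cross2 (y *\<^sub>R u + z *\<^sub>R v) u\<bar>)"
    using angle_eq_arctan[of "x *\<^sub>R A + y *\<^sub>R B + z *\<^sub>R C" A B] K \<open>z > 0\<close>
    unfolding X u_def[symmetric] cr by (simp add: u_def v_def)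
  also have "((y *\<^sub>R u + z *\<^sub>R v) \<bullet> u) / \<bar>cross2 (y *\<^sub>R u + z *\<^sub>R v) u\<bar> =
      (y / z * (norm u)\<^sup>2 + u \<bullet> v) / \<bar>cross2 u v\<bar>"
    using \<open>z > 0\<close> K
    by (simp add: cr abs_mult inner_add_left power2_norm_eq_inner inner_commute[of v u]
        field_simps flip: u_def v_def)
  finally show ?thesis by (simp add: u_def v_def)
qed

section \<open>Brocard points\<close>

text \<open>
  The algebraic core of uniqueness: the common value of the three expressions vanishes, since the
  product of the three ratios is 1.
\<close>

lemma cyclic_ratio_system:
  fixes \<alpha> \<beta> \<gamma> x y z :: real
  assumes pos: "\<alpha> > 0" "\<beta> > 0" "\<gamma> > 0" "x > 0" "y > 0" "z > 0"
  shows "\<gamma> * (y / z) - \<alpha> = \<alpha> * (z / x) - \<beta> \<and> \<alpha> * (z / x) - \<beta> = \<beta> * (x / y) - \<gamma> \<longleftrightarrow>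
    x * \<beta> = y * \<gamma> \<and> y * \<gamma> = z * \<alpha>" (is "?L \<longleftrightarrow> ?R")
proof
  assume ?L
  define k where "k = \<gamma> * (y / z) - \<alpha>"
  have e: "\<alpha> + k = \<gamma> * (y / z)" "\<beta> + k = \<alpha> * (z / x)" "\<gamma> + k = \<beta> * (x / y)"
    using \<open>?L\<close> by (auto simp: k_def)
  have p: "\<alpha> + k > 0" "\<beta> + k > 0" "\<gamma> + k > 0"
    unfolding e using pos by auto
  have prod: "(\<alpha> + k) * (\<beta> + k) * (\<gamma> + k) = \<alpha> * \<beta> * \<gamma>"
    unfolding e using pos by simp
  have "k = 0"
  proof (rule ccontr)
    assume "k \<noteq> 0"
    then consider "k > 0" | "k < 0" by linarith
    then show False
    proof cases
      case 1
      then have "(\<alpha> + k) * (\<beta> + k) * (\<gamma> + k) > \<alpha> * \<beta> * \<gamma>"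
        using pos by (intro mult_strict_mono) auto
      then show False using prod by simp
    next
      case 2
      then have "(\<alpha> + k) * (\<beta> + k) * (\<gamma> + k) < \<alpha> * \<beta> * \<gamma>"
        using pos p by (intro mult_strict_mono) (auto intro: less_imp_le)
      then show False using prod by simp
    qed
  qed
  then show ?R using e pos by (auto simp: field_simps)
next
  assume R: ?R
  have "\<gamma> * (y / z) = \<alpha>" "\<alpha> * (z / x) = \<beta>" "\<beta> * (x / y) = \<gamma>"
    using R pos by (auto simp: field_simps)
  then show ?L by simp
qed

lemma brocard_angles_iff:
  assumes nc: "\<not> collinear {A, B, C}"
    and bary: "x > 0" "y > 0" "z > 0" "x + y + z = 1" "X = x *\<^sub>R A + y *\<^sub>R B + z *\<^sub>R C"
  shows "angle X A B = angle X B C \<and> angle X B C = angle X C A \<longleftrightarrow>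
    x * (dist C A)\<^sup>2 = y * (dist A B)\<^sup>2 \<and> y * (dist A B)\<^sup>2 = z * (dist B C)\<^sup>2"
proof -
  define K where "K = \<bar>cross2 (B - A) (C - A)\<bar>"
  define \<alpha> \<beta> \<gamma> where "\<alpha> = (dist B C)\<^sup>2" and "\<beta> = (dist C A)\<^sup>2" and "\<gamma> = (dist A B)\<^sup>2"
  \<comment> \<open>Half the sum of the squared sides; by the law of cosines it turns each inner product at a
    vertex into \<open>\<sigma>\<close> minus the square of the opposite side.\<close>
  define \<sigma> where "\<sigma> = (\<alpha> + \<beta> + \<gamma>) / 2"
  have K0: "cross2 (B - A) (C - A) \<noteq> 0"
    using nc by (simp add: collinear_iff_cross2)
  then have K: "K > 0" by (simp add: K_def)
  have KB: "cross2 (C - B) (A - B) = cross2 (B - A) (C - A)"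
    and KC: "cross2 (A - C) (B - C) = cross2 (B - A) (C - A)"
    by (simp_all add: cross2_def algebra_simps)
  have SA: "(B - A) \<bullet> (C - A) = \<sigma> - \<alpha>"
    and SB: "(C - B) \<bullet> (A - B) = \<sigma> - \<beta>"
    and SC: "(A - C) \<bullet> (B - C) = \<sigma> - \<gamma>"
    unfolding \<sigma>_def \<alpha>_def \<beta>_def \<gamma>_def dist_norm power2_norm_eq_inner
    by (simp_all add: algebra_simps inner_commute field_simps)
  have XB: "X = y *\<^sub>R B + z *\<^sub>R C + x *\<^sub>R A" and XC: "X = z *\<^sub>R C + x *\<^sub>R A + y *\<^sub>R B"
    using bary by (simp_all add: algebra_simps)
  have A: "angle X A B = pi / 2 - arctan ((\<gamma> * (y / z) - \<alpha> + \<sigma>) / K)"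
    using angle_in_barycentric[of x y z B A C] bary K0
    unfolding bary(5) SA K_def[symmetric]
    by (simp add: \<gamma>_def dist_norm norm_minus_commute algebra_simps)
  have B: "angle X B C = pi / 2 - arctan ((\<alpha> * (z / x) - \<beta> + \<sigma>) / K)"
    using angle_in_barycentric[of y z x C B A] bary(1-4) K0
    unfolding XB SB KB K_def[symmetric]
    by (simp add: \<alpha>_def dist_norm norm_minus_commute algebra_simps)
  have C: "angle X C A = pi / 2 - arctan ((\<beta> * (x / y) - \<gamma> + \<sigma>) / K)"
    using angle_in_barycentric[of z x y A C B] bary(1-4) K0
    unfolding XC SC KC K_def[symmetric]
    by (simp add: \<beta>_def dist_norm norm_minus_commute algebra_simps)
  have "A \<noteq> B" "B \<noteq> C" "C \<noteq> A" using nc by (auto simp: insert_commute)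
  then have "\<alpha> > 0" "\<beta> > 0" "\<gamma> > 0" by (auto simp: \<alpha>_def \<beta>_def \<gamma>_def)
  from cyclic_ratio_system[OF this bary(1-3)] show ?thesis
    unfolding A B C using K
    by (simp add: arctan_eq_iff \<alpha>_def[symmetric] \<beta>_def[symmetric] \<gamma>_def[symmetric])
qed

lemma brocard1_eqI:
  assumes nc: "\<not> collinear {A, B, C}"
    and bary: "x > 0" "y > 0" "z > 0" "x + y + z = 1"
    and weights: "x * (dist C A)\<^sup>2 = y * (dist A B)\<^sup>2" "y * (dist A B)\<^sup>2 = z * (dist B C)\<^sup>2"
  shows "brocard1 A B C = x *\<^sub>R A + y *\<^sub>R B + z *\<^sub>R C"
  unfolding brocard1_def
proof (rule the_equality)
  have int: "interior (convex hull {A, B, C}) =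
    {v. \<exists>x y z. 0 < x \<and> 0 < y \<and> 0 < z \<and> x + y + z = 1 \<and> x *\<^sub>R A + y *\<^sub>R B + z *\<^sub>R C = v}"
    by (rule interior_convex_hull_3_minimal[OF nc]) simp
  let ?X = "x *\<^sub>R A + y *\<^sub>R B + z *\<^sub>R C"
  show "?X \<in> interior (convex hull {A, B, C}) \<and>
      angle ?X A B = angle ?X B C \<and> angle ?X B C = angle ?X C A"
    using brocard_angles_iff[OF nc bary refl] bary weights unfolding int by blast
  fix Y
  assume Y: "Y \<in> interior (convex hull {A, B, C}) \<and>
      angle Y A B = angle Y B C \<and> angle Y B C = angle Y C A"
  then obtain x' y' z' where
    bary': "x' > 0" "y' > 0" "z' > 0" "x' + y' + z' = 1" "Y = x' *\<^sub>R A + y' *\<^sub>R B + z' *\<^sub>R C"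
    unfolding int by blast
  have weights': "x' * (dist C A)\<^sup>2 = y' * (dist A B)\<^sup>2" "y' * (dist A B)\<^sup>2 = z' * (dist B C)\<^sup>2"
    using brocard_angles_iff[OF nc bary'] Y by auto
  have "A \<noteq> B" "B \<noteq> C" "C \<noteq> A" using nc by (auto simp: insert_commute)
  then have pos: "(dist B C)\<^sup>2 > 0" "(dist C A)\<^sup>2 > 0" "(dist A B)\<^sup>2 > 0" by auto
  \<comment> \<open>The two triples of weights are proportional with the same sum.\<close>
  define r where "r = z' / z"
  have z: "z' = r * z" using bary by (simp add: r_def)
  have "y' * (dist A B)\<^sup>2 = r * y * (dist A B)\<^sup>2"
    using weights'(2) weights(2) z by simp
  then have y: "y' = r * y" using pos by simp
  have "x' * (dist C A)\<^sup>2 = r * x * (dist C A)\<^sup>2"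
    using weights'(1) weights(1) y by simp
  then have x: "x' = r * x" using pos by simp
  have "r * (x + y + z) = 1" using bary'(4) x y z by (simp add: algebra_simps)
  then have "r = 1" using bary by simp
  then show "Y = ?X" using bary'(5) x y z by simp
qed

text \<open>Exchanging two vertices reverses the orientation and hence swaps the Brocard points.\<close>

lemma brocard2_eq_brocard1: "brocard2 A B C = brocard1 A C B"
  unfolding brocard1_def brocard2_def insert_commute[of C B]
  by (rule arg_cong[where f = The]) (auto simp: fun_eq_iff)

section \<open>Explicit form of the two loci\<close>

definition omega1 :: "real \<Rightarrow> real \<Rightarrow> point" where
  "omega1 a t = (a * cos t / (5 - 4 * sin t), a * (2 - sin t) / (5 - 4 * sin t))"

definition omega2 :: "real \<Rightarrow> real \<Rightarrow> point" where
  "omega2 a t = (a * (2 * (1 - sin t) * cos t) / (5 - 4 * sin t),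
                 a * (1 + 2 * sin t * (1 - sin t)) / (5 - 4 * sin t))"

lemma denominator_pos: "5 - 4 * sin t > (0::real)"
  using sin_le_one[of t] by linarith

lemma collinear_triangle_iff:
  assumes "a > 0"
  shows "collinear {V1, V2 a, P a t} \<longleftrightarrow> cos t = 0"
  using assms by (simp add: collinear_iff_cross2 cross2_def V1_def V2_def P_def)

lemma sin_less_one_if_cos_nonzero:
  fixes t :: real
  assumes "cos t \<noteq> 0"
  shows "sin t < 1"
proof -
  have "(sin t)\<^sup>2 \<noteq> 1"
    unfolding sin_squared_eq using assms by simp
  then have "sin t \<noteq> 1" by auto
  then show ?thesis using sin_le_one[of t] by linarith
qed

text \<open>The Brocard weights are \<open>d : d : 1\<close> and \<open>d : 1 : d\<close> with \<open>d = 2 (1 - sin t)\<close>.\<close>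

lemma brocard_triangle:
  assumes "a > 0" "cos t \<noteq> 0"
  shows brocard1_triangle: "brocard1 V1 (V2 a) (P a t) = omega1 a t"
    and brocard2_triangle: "brocard2 V1 (V2 a) (P a t) = omega2 a t"
proof -
  define q d where "q = 5 - 4 * sin t" and "d = 2 * (1 - sin t)"
  have q: "q > 0" "q = 2 * d + 1" and d: "d > 0"
    using denominator_pos[of t] sin_less_one_if_cos_nonzero[OF assms(2)]
    by (simp_all add: q_def d_def)
  have nc: "\<not> collinear {V1, V2 a, P a t}" "\<not> collinear {V1, P a t, V2 a}"
    using collinear_triangle_iff[OF assms(1), of t] assms(2) by (simp_all add: insert_commute)
  have radius: "(a * cos t)\<^sup>2 + (a * sin t)\<^sup>2 = a\<^sup>2"
    unfolding power_mult_distrib distrib_left[symmetric] by simp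
  then have [simp]: "(dist V1 (V2 a))\<^sup>2 = a\<^sup>2" "(dist V1 (P a t))\<^sup>2 = a\<^sup>2"
    by (simp_all add: dist_norm V1_def V2_def P_def norm_Pair)
  have [simp]: "(dist (V2 a) (P a t))\<^sup>2 = d * a\<^sup>2"
  proof -
    have "(dist (V2 a) (P a t))\<^sup>2 = (a * cos t)\<^sup>2 + (a - a * sin t)\<^sup>2"
      by (simp add: dist_norm V2_def P_def norm_Pair)
    also have "\<dots> = ((a * cos t)\<^sup>2 + (a * sin t)\<^sup>2) + a\<^sup>2 * (1 - 2 * sin t)"
      by (simp add: power2_eq_square algebra_simps)
    finally show ?thesis unfolding radius by (simp add: d_def algebra_simps)
  qed
  have weights: "d / q > 0" "1 / q > 0" "d / q + d / q + 1 / q = 1"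
    using q(1) d unfolding add_divide_distrib[symmetric] by (simp_all add: q(2))
  have "brocard1 V1 (V2 a) (P a t) = (d / q) *\<^sub>R V1 + (d / q) *\<^sub>R V2 a + (1 / q) *\<^sub>R P a t"
    by (intro brocard1_eqI nc weights) (simp_all add: dist_commute[of "P a t"])
  also have "\<dots> = (a * (cos t / q), a * ((d + sin t) / q))"
    by (simp add: V1_def V2_def P_def add_divide_distrib ring_distribs mult.commute)
  also have "d + sin t = 2 - sin t" by (simp add: d_def)
  finally show "brocard1 V1 (V2 a) (P a t) = omega1 a t"
    by (simp only: omega1_def q_def times_divide_eq_right)
  have "brocard1 V1 (P a t) (V2 a) = (d / q) *\<^sub>R V1 + (1 / q) *\<^sub>R V2 a + (d / q) *\<^sub>R P a t"
    using brocard1_eqI[OF nc(2) weights(1,1,2,3)]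
    by (simp add: dist_commute[of "V2 a" V1] dist_commute[of "P a t" "V2 a"] ac_simps)
  also have "\<dots> = (a * (d * cos t / q), a * ((1 + d * sin t) / q))"
    by (simp add: V1_def V2_def P_def add_divide_distrib ring_distribs ac_simps)
  finally show "brocard2 V1 (V2 a) (P a t) = omega2 a t"
    by (simp only: brocard2_eq_brocard1 omega2_def q_def d_def times_divide_eq_right) simp
qed

text \<open>The zeros of the cosine are simple, hence isolated.\<close>

lemma eventually_cos_nonzero: "\<forall>\<^sub>F s in at t. cos s \<noteq> (0::real)"
proof (cases "cos t = 0")
  case False
  then show ?thesis
    by (rule tendsto_imp_eventually_ne[OF tendsto_cos[OF tendsto_ident_at]])
next
  case True
  then have "sin t \<noteq> 0" using sin_cos_squared_add[of t] by auto
  have "((\<lambda>s. (cos s - cos t) / (s - t)) \<longlongrightarrow> - sin t) (at t)"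
    using DERIV_cos[of t] by (simp add: has_field_derivative_iff)
  then have "\<forall>\<^sub>F s in at t. (cos s - cos t) / (s - t) \<noteq> 0"
    by (rule tendsto_imp_eventually_ne) (use \<open>sin t \<noteq> 0\<close> in simp)
  then show ?thesis by eventually_elim (auto simp: True)
qed

lemma Lim_eq_if_cos_nonzero:
  fixes f g :: "real \<Rightarrow> point"
  assumes "\<And>s. cos s \<noteq> 0 \<Longrightarrow> f s = g s" "isCont g t"
  shows "Lim (at t) f = g t"
proof (rule tendsto_Lim)
  have "\<forall>\<^sub>F s in at t. g s = f s"
    using eventually_cos_nonzero[of t] by eventually_elim (use assms in auto)
  then show "(f \<longlongrightarrow> g t) (at t)"
    using isContD[OF assms(2)] tendsto_cong by blast
qed simp

lemma denominator_nonzero: "5 - 4 * sin t \<noteq> (0::real)"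
  using denominator_pos[of t] by simp

lemma Omega1_eq:
  assumes "a > 0"
  shows "Omega1 a = omega1 a"
proof
  fix t
  have "isCont (omega1 a) t"
    unfolding omega1_def by (intro continuous_intros denominator_nonzero)
  then show "Omega1 a t = omega1 a t"
    using Lim_eq_if_cos_nonzero[of "\<lambda>s. brocard1 V1 (V2 a) (P a s)" "omega1 a"]
    by (simp add: Omega1_def collinear_triangle_iff[OF assms] brocard1_triangle[OF assms])
qed

lemma Omega2_eq:
  assumes "a > 0"
  shows "Omega2 a = omega2 a"
proof
  fix t
  have "isCont (omega2 a) t"
    unfolding omega2_def by (intro continuous_intros denominator_nonzero)
  then show "Omega2 a t = omega2 a t"
    using Lim_eq_if_cos_nonzero[of "\<lambda>s. brocard2 V1 (V2 a) (P a s)" "omega2 a"]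
    by (simp add: Omega2_def collinear_triangle_iff[OF assms] brocard2_triangle[OF assms])
qed

text \<open>
  The parametrisation has a rational inverse on the circle, and the equation of the circle makes the
  candidates for cosine and sine satisfy the Pythagorean identity.
\<close>

lemma omega1_image:
  assumes a: "a > 0"
  shows "omega1 a ` {0..<2 * pi} = sphere (0, 2 * a / 3) (a / 3)"
proof -
  have mem: "p \<in> sphere (0, 2 * a / 3) (a / 3) \<longleftrightarrow>
      (fst p)\<^sup>2 + (snd p - 2 * a / 3)\<^sup>2 = (a / 3)\<^sup>2" for p :: point
  proof -
    have "p \<in> sphere (0, 2 * a / 3) (a / 3) \<longleftrightarrow> (dist (0, 2 * a / 3) p)\<^sup>2 = (a / 3)\<^sup>2"
      using a by (subst power2_eq_iff_nonneg) auto
    also have "(dist (0, 2 * a / 3) p)\<^sup>2 = (fst p)\<^sup>2 + (snd p - 2 * a / 3)\<^sup>2"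
      by (simp add: dist_prod_def dist_real_def power2_commute)
    finally show ?thesis .
  qed
  show ?thesis
  proof (intro subset_antisym subsetI)
    fix p :: point assume "p \<in> omega1 a ` {0..<2 * pi}"
    then obtain t where p: "p = omega1 a t" by auto
    define q where "q = 5 - 4 * sin t"
    have q: "q \<noteq> 0" and s: "sin t = (5 - q) / 4"
      using denominator_nonzero[of t] by (simp_all add: q_def)
    have c: "(cos t)\<^sup>2 = 1 - ((5 - q) / 4)\<^sup>2"
      using sin_cos_squared_add[of t] by (simp add: s)
    have "(fst p)\<^sup>2 + (snd p - 2 * a / 3)\<^sup>2 =
        (a / q)\<^sup>2 * (cos t)\<^sup>2 + (a * (2 - (5 - q) / 4) / q - 2 * a / 3)\<^sup>2"
      unfolding p omega1_def q_def[symmetric] unfolding s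
      by (simp add: power_mult_distrib power_divide)
    also have "\<dots> = (a / 3)\<^sup>2"
      unfolding c using q by (simp add: power2_eq_square field_simps)
    finally show "p \<in> sphere (0, 2 * a / 3) (a / 3)" unfolding mem .
  next
    fix p :: point assume "p \<in> sphere (0, 2 * a / 3) (a / 3)"
    define x y where "x = fst p / a" and "y = snd p / a"
    have p: "p = (a * x, a * y)" using a by (simp add: x_def y_def)
    have "a\<^sup>2 * (x\<^sup>2 + (y - 2 / 3)\<^sup>2) = a\<^sup>2 * (1 / 9)"
      using \<open>p \<in> _\<close> unfolding mem p by (simp add: power2_eq_square algebra_simps)
    then have circ: "x\<^sup>2 + (y - 2 / 3)\<^sup>2 = 1 / 9" using a by simp
    then have "(y - 2 / 3)\<^sup>2 \<le> 1 / 9"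
      using zero_le_power2[of x] by linarith
    then have "\<bar>y - 2 / 3\<bar> \<le> 1 / 3"
      using abs_le_square_iff[of "y - 2 / 3" "1 / 3"] by (simp add: power_divide)
    then have y: "4 * y - 1 > 0" by linarith
    \<comment> \<open>Cosine and sine of the parameter, obtained by solving \<open>y = (2 - s) / (5 - 4 s)\<close> for \<open>s\<close>.\<close>
    define c s where "c = 3 * x / (4 * y - 1)" and "s = (5 * y - 2) / (4 * y - 1)"
    have "c\<^sup>2 + s\<^sup>2 = (9 * x\<^sup>2 + (5 * y - 2)\<^sup>2) / (4 * y - 1)\<^sup>2"
      by (simp add: c_def s_def power_divide power_mult_distrib add_divide_distrib)
    also have "9 * x\<^sup>2 + (5 * y - 2)\<^sup>2 = (4 * y - 1)\<^sup>2"
      using circ by (simp add: power2_eq_square algebra_simps)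
    finally have "c\<^sup>2 + s\<^sup>2 = 1" using y by simp
    then obtain t where t: "0 \<le> t" "t < 2 * pi" "c = cos t" "s = sin t"
      using sincos_total_2pi by metis
    have q: "5 - 4 * s = 3 / (4 * y - 1)" using y by (simp add: s_def field_simps)
    have "omega1 a t = p"
      unfolding omega1_def t(3,4)[symmetric] q p
      using y by (simp add: c_def s_def field_simps)
    then show "p \<in> omega1 a ` {0..<2 * pi}" using t by force
  qed
qed

section \<open>Velocities and enclosed areas\<close>

definition velocity1 :: "real \<Rightarrow> real \<Rightarrow> point" where
  "velocity1 a t = (a * (4 - 5 * sin t) / (5 - 4 * sin t)\<^sup>2, a * (3 * cos t) / (5 - 4 * sin t)\<^sup>2)"

definition velocity2 :: "real \<Rightarrow> real \<Rightarrow> point" where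
  "velocity2 a t =
    (a * (- 2 * (1 - sin t) * (1 + 6 * sin t - 4 * (sin t)\<^sup>2)) / (5 - 4 * sin t)\<^sup>2,
     a * (2 * cos t * (7 - 10 * sin t + 4 * (sin t)\<^sup>2)) / (5 - 4 * sin t)\<^sup>2)"

lemma cos_mult_cos: "cos t * cos t = 1 - sin t * sin (t::real)"
  using sin_cos_squared_add[of t] by (simp add: power2_eq_square)

lemma cos_mult_cos_mult: "cos t * (cos t * x) = x - sin t * (sin t * (x::real))"
  using cos_mult_cos[of t] by (metis (no_types) left_diff_distrib mult.assoc mult_1)

lemma omega1_has_derivative: "(omega1 a has_vector_derivative velocity1 a t) (at t)"
  unfolding omega1_def velocity1_def
proof (rule has_vector_derivative_Pair)
  show "((\<lambda>t. a * cos t / (5 - 4 * sin t)) has_vector_derivative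
      a * (4 - 5 * sin t) / (5 - 4 * sin t)\<^sup>2) (at t)"
    unfolding has_real_derivative_iff_has_vector_derivative[symmetric]
    by (rule derivative_eq_intros refl denominator_nonzero)+
       (simp add: power2_eq_square, simp add: algebra_simps cos_mult_cos cos_mult_cos_mult)
  show "((\<lambda>t. a * (2 - sin t) / (5 - 4 * sin t)) has_vector_derivative
      a * (3 * cos t) / (5 - 4 * sin t)\<^sup>2) (at t)"
    unfolding has_real_derivative_iff_has_vector_derivative[symmetric]
    by (rule derivative_eq_intros refl denominator_nonzero)+
       (simp add: power2_eq_square, simp add: algebra_simps)
qed

lemma omega2_has_derivative: "(omega2 a has_vector_derivative velocity2 a t) (at t)"
  unfolding omega2_def velocity2_def
proof (rule has_vector_derivative_Pair)
  show "((\<lambda>t. a * (2 * (1 - sin t) * cos t) / (5 - 4 * sin t)) has_vector_derivative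
      a * (- 2 * (1 - sin t) * (1 + 6 * sin t - 4 * (sin t)\<^sup>2)) / (5 - 4 * sin t)\<^sup>2) (at t)"
    unfolding has_real_derivative_iff_has_vector_derivative[symmetric]
    by (rule derivative_eq_intros refl denominator_nonzero)+
       (simp add: power2_eq_square, simp add: algebra_simps cos_mult_cos cos_mult_cos_mult)
  show "((\<lambda>t. a * (1 + 2 * sin t * (1 - sin t)) / (5 - 4 * sin t)) has_vector_derivative
      a * (2 * cos t * (7 - 10 * sin t + 4 * (sin t)\<^sup>2)) / (5 - 4 * sin t)\<^sup>2) (at t)"
    unfolding has_real_derivative_iff_has_vector_derivative[symmetric]
    by (rule derivative_eq_intros refl denominator_nonzero)+
       (simp add: power2_eq_square, simp add: algebra_simps)
qed

lemma closed_curveI: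
  assumes deriv: "\<And>t. (\<gamma> has_vector_derivative \<gamma>' t) (at t)"
    and cont: "continuous_on UNIV \<gamma>'" and period: "\<gamma> (2 * pi) = \<gamma> 0"
  shows "closed_curve \<gamma>"
proof -
  have "(revolution \<gamma> has_vector_derivative (2 * pi) *\<^sub>R \<gamma>' (2 * pi * u)) (at u)" for u
  proof -
    have "((\<lambda>u. 2 * pi * u) has_vector_derivative 2 * pi) (at u)"
      unfolding has_real_derivative_iff_has_vector_derivative[symmetric]
      by (auto intro!: derivative_eq_intros)
    from vector_diff_chain_at[OF this deriv] show ?thesis
      by (simp add: revolution_def o_def)
  qed
  moreover have "continuous_on {0..1} (\<lambda>u. (2 * pi) *\<^sub>R \<gamma>' (2 * pi * u))"
    by (intro continuous_intros continuous_on_compose2[OF cont]) auto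
  ultimately have "revolution \<gamma> C1_differentiable_on {0..1}"
    unfolding C1_differentiable_on_def by (intro exI[of _ "\<lambda>u. (2 * pi) *\<^sub>R \<gamma>' (2 * pi * u)"]) simp
  then have "valid_path (revolution \<gamma>)"
    unfolding valid_path_def by (rule C1_differentiable_imp_piecewise)
  then show ?thesis
    using period by (simp add: closed_curve_def pathstart_def pathfinish_def revolution_def)
qed

lemma closed_curve_omega1: "closed_curve (omega1 a)"
  by (rule closed_curveI[OF omega1_has_derivative])
     (use denominator_nonzero in \<open>auto simp: velocity1_def omega1_def intro!: continuous_intros\<close>)

lemma closed_curve_omega2: "closed_curve (omega2 a)"
  by (rule closed_curveI[OF omega2_has_derivative])
     (use denominator_nonzero in \<open>auto simp: velocity2_def omega2_def intro!: continuous_intros\<close>)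

text \<open>
  The function \<open>3 / (5 - 4 sin t)\<close> is the Poisson kernel with radius \<open>1 / 2\<close>. Integrating its Fourier
  series termwise suggests a primitive that, unlike the one from the half-angle substitution, is smooth on
  the whole period.
\<close>

lemma poisson_kernel_primitive:
  "((\<lambda>t. t / 3 - 2 / 3 * arctan (cos t / (2 - sin t))) has_real_derivative
    1 / (5 - 4 * sin t)) (at t)"
proof -
  define s c where "s = sin t" and "c = cos t"
  have s: "2 - s \<noteq> 0" "5 - 4 * s \<noteq> 0" and cc: "c\<^sup>2 = 1 - s\<^sup>2"
    using sin_le_one[of t] denominator_nonzero[of t] cos_squared_eq[of t]
    by (auto simp: s_def c_def simp del: sin_le_one)
  have q: "1 + (c / (2 - s))\<^sup>2 = (5 - 4 * s) / (2 - s)\<^sup>2"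
  proof -
    have "1 + (c / (2 - s))\<^sup>2 = ((2 - s)\<^sup>2 + c\<^sup>2) / (2 - s)\<^sup>2"
      using s(1) by (simp add: power_divide add_divide_distrib)
    also have "(2 - s)\<^sup>2 + c\<^sup>2 = 5 - 4 * s"
      unfolding cc by (simp add: power2_eq_square algebra_simps)
    finally show ?thesis .
  qed
  have *: "((\<lambda>t. cos t / (2 - sin t)) has_real_derivative (1 - 2 * s) / (2 - s)\<^sup>2) (at t)"
    by (rule derivative_eq_intros refl s(1)[unfolded s_def])+
       (use cos_mult_cos[of t] in \<open>simp add: s_def power2_eq_square algebra_simps\<close>)
  have "((\<lambda>t. t / 3 - 2 / 3 * arctan (cos t / (2 - sin t))) has_real_derivative
      1 / 3 - 2 / 3 * (inverse (1 + (c / (2 - s))\<^sup>2) * ((1 - 2 * s) / (2 - s)\<^sup>2))) (at t)"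
    unfolding s_def c_def
    by (rule DERIV_diff DERIV_cmult DERIV_cdivide DERIV_ident
        DERIV_chain2[OF DERIV_arctan *[unfolded s_def]])+
  also have "1 / 3 - 2 / 3 * (inverse (1 + (c / (2 - s))\<^sup>2) * ((1 - 2 * s) / (2 - s)\<^sup>2)) =
      1 / 3 - 2 / 3 * ((1 - 2 * s) / (5 - 4 * s))"
    unfolding q using s by simp
  also have "\<dots> = 1 / (5 - 4 * s)"
    using s(2) by (simp add: field_simps)
  finally show ?thesis unfolding s_def .
qed

text \<open>
  The first summand is the derivative of the periodic function \<open>m cos t / (5 - 4 sin t)\<close>; only the
  multiple of the Poisson kernel contributes over a full period.
\<close>

lemma area_integral:
  "((\<lambda>t. (m * (4 - 5 * sin t) + n * (5 - 4 * sin t)) / (5 - 4 * sin t)\<^sup>2)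
    has_integral n * (2 * pi / 3)) {0..2 * pi}"
proof -
  define F where "F = (\<lambda>t. m * (cos t / (5 - 4 * sin t))
    + n * (t / 3 - 2 / 3 * arctan (cos t / (2 - sin t))))"
  have "(F has_real_derivative
      (m * (4 - 5 * sin t) + n * (5 - 4 * sin t)) / (5 - 4 * sin t)\<^sup>2) (at t)" for t
  proof -
    have "((\<lambda>t. cos t / (5 - 4 * sin t)) has_real_derivative
        (4 - 5 * sin t) / (5 - 4 * sin t)\<^sup>2) (at t)"
      by (rule derivative_eq_intros refl denominator_nonzero)+
         (simp add: power2_eq_square, simp add: algebra_simps cos_mult_cos cos_mult_cos_mult)
    then have "(F has_real_derivative
        m * ((4 - 5 * sin t) / (5 - 4 * sin t)\<^sup>2) + n * (1 / (5 - 4 * sin t))) (at t)"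
      unfolding F_def by (intro DERIV_add DERIV_cmult poisson_kernel_primitive)
    then show ?thesis
      using denominator_nonzero[of t]
      by (simp add: add_divide_distrib power2_eq_square)
  qed
  then have "((\<lambda>t. (m * (4 - 5 * sin t) + n * (5 - 4 * sin t)) / (5 - 4 * sin t)\<^sup>2)
      has_integral (F (2 * pi) - F 0)) {0..2 * pi}"
    by (intro fundamental_theorem_of_calculus)
       (auto simp: has_real_derivative_iff_has_vector_derivative
         intro: has_vector_derivative_at_within)
  then show ?thesis by (simp add: F_def algebra_simps)
qed

lemma encloses_areaI:
  assumes "closed_curve \<gamma>" and "\<And>t. (\<gamma> has_vector_derivative \<gamma>' t) (at t)"
    and "\<And>t. fst (\<gamma> t) * snd (\<gamma>' t) - snd (\<gamma> t) * fst (\<gamma>' t) =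
      (m * (4 - 5 * sin t) + n * (5 - 4 * sin t)) / (5 - 4 * sin t)\<^sup>2"
    and "n \<ge> 0"
  shows "encloses_area \<gamma> (n * pi / 3)"
  unfolding encloses_area_def
proof (intro conjI exI)
  have "vector_derivative \<gamma> (at t) = \<gamma>' t" for t
    using assms(2) by (rule vector_derivative_at)
  then show "((\<lambda>t. fst (\<gamma> t) * snd (vector_derivative \<gamma> (at t))
              - snd (\<gamma> t) * fst (vector_derivative \<gamma> (at t))) has_integral n * (2 * pi / 3)) {0..2 * pi}"
    using area_integral[of m n] assms(3) by simp
qed (use assms in auto)

text \<open>
  The numerator of the area integrand has a factor \<open>5 - 4 sin t\<close>; cancelling it leaves
  \<open>a\<^sup>2 (2 sin t - 1)\<close> and \<open>6 a\<^sup>2 (1 - sin t)\<close> for the two curves. These are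
  then expanded in the basis \<open>4 - 5 sin t\<close>, \<open>5 - 4 sin t\<close> of \<open>area_integral\<close>.
\<close>

lemma area_omega1: "encloses_area (omega1 a) (pi * a\<^sup>2 / 9)"
proof -
  have "fst (omega1 a t) * snd (velocity1 a t) - snd (omega1 a t) * fst (velocity1 a t) =
      (- 2 / 3 * a\<^sup>2 * (4 - 5 * sin t) + a\<^sup>2 / 3 * (5 - 4 * sin t)) / (5 - 4 * sin t)\<^sup>2"
    (is "?lhs = ?rhs") for t
  proof -
    define s q where "s = sin t" and "q = 5 - 4 * sin t"
    have q: "q \<noteq> 0" using denominator_nonzero[of t] by (simp add: q_def)
    have "?lhs = a\<^sup>2 * (3 * (cos t * cos t) - (2 - s) * (4 - 5 * s)) / (q * q\<^sup>2)"
      by (simp add: omega1_def velocity1_def s_def flip: q_def)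
         (simp add: power2_eq_square algebra_simps diff_divide_distrib add_divide_distrib)
    also have "3 * (cos t * cos t) - (2 - s) * (4 - 5 * s) = (2 * s - 1) * q"
      unfolding cos_mult_cos by (simp add: s_def q_def field_simps)
    also have "a\<^sup>2 * ((2 * s - 1) * q) / (q * q\<^sup>2) = a\<^sup>2 * (2 * s - 1) / q\<^sup>2"
      using q by simp
    also have "\<dots> = ?rhs"
      unfolding q_def[symmetric]
      by (rule arg_cong[where f = "\<lambda>x. x / q\<^sup>2"]) (simp add: s_def q_def field_simps)
    finally show ?thesis .
  qed
  from encloses_areaI[OF closed_curve_omega1 omega1_has_derivative this] show ?thesis
    by (simp add: mult.commute)
qed

lemma area_omega2: "encloses_area (omega2 a) (2 * pi * a\<^sup>2 / 9)"
proof -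
  have "fst (omega2 a t) * snd (velocity2 a t) - snd (omega2 a t) * fst (velocity2 a t) =
      (2 / 3 * a\<^sup>2 * (4 - 5 * sin t) + 2 / 3 * a\<^sup>2 * (5 - 4 * sin t)) / (5 - 4 * sin t)\<^sup>2"
    (is "?lhs = ?rhs") for t
  proof -
    define s q where "s = sin t" and "q = 5 - 4 * sin t"
    have q: "q \<noteq> 0" using denominator_nonzero[of t] by (simp add: q_def)
    have "?lhs = a\<^sup>2 * (4 * (1 - s) * (cos t * cos t) * (7 - 10 * s + 4 * s\<^sup>2) +
        2 * (1 + 2 * s * (1 - s)) * (1 - s) * (1 + 6 * s - 4 * s\<^sup>2)) / (q * q\<^sup>2)"
      unfolding omega2_def velocity2_def fst_conv snd_conv
        q_def[symmetric] times_divide_times_eq diff_divide_distrib[symmetric]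
      unfolding s_def[symmetric]
      by (rule arg_cong[where f = "\<lambda>x. x / (q * q\<^sup>2)"]) algebra
    also have "4 * (1 - s) * (cos t * cos t) * (7 - 10 * s + 4 * s\<^sup>2) +
        2 * (1 + 2 * s * (1 - s)) * (1 - s) * (1 + 6 * s - 4 * s\<^sup>2) = 6 * (1 - s) * q"
      unfolding cos_mult_cos s_def q_def by algebra
    also have "a\<^sup>2 * (6 * (1 - s) * q) / (q * q\<^sup>2) = a\<^sup>2 * (6 * (1 - s)) / q\<^sup>2"
      using q by simp
    also have "\<dots> = ?rhs"
      unfolding q_def[symmetric]
      by (rule arg_cong[where f = "\<lambda>x. x / q\<^sup>2"]) (simp add: s_def q_def field_simps)
    finally show ?thesis .
  qed
  from encloses_areaI[OF closed_curve_omega2 omega2_has_derivative this] show ?thesis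
    by (simp add: mult_ac)
qed

section \<open>The teardrop\<close>

lemma omega2_eq_imp:
  assumes a: "a > 0" and eq: "omega2 a t = omega2 a u"
  shows "sin t = sin u \<and> cos t = cos u"
proof -
  define s r where "s = sin t" and "r = sin u"
  have sr: "s \<le> 1" "r \<le> 1" and q: "5 - 4 * s > 0" "5 - 4 * r > 0"
    using denominator_pos[of t] denominator_pos[of u] by (simp_all add: s_def r_def)
  have "(1 + 2 * s * (1 - s)) / (5 - 4 * s) = (1 + 2 * r * (1 - r)) / (5 - 4 * r)"
    using eq a by (simp add: omega2_def s_def r_def flip: times_divide_eq_right)
  then have "(1 + 2 * s * (1 - s)) * (5 - 4 * r) = (1 + 2 * r * (1 - r)) * (5 - 4 * s)"
    using q by (simp add: frac_eq_eq)
  \<comment> \<open>Up to a positive denominator, the second factor is the difference quotient of the ordinate as a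
    function of the sine, arranged in the nonnegative quantities \<open>1 - s\<close> and \<open>1 - r\<close>.\<close>
  moreover have "(s - r) * (2 + 2 * (1 - s) + 2 * (1 - r) + 8 * ((1 - s) * (1 - r))) =
      (1 + 2 * s * (1 - s)) * (5 - 4 * r) - (1 + 2 * r * (1 - r)) * (5 - 4 * s)"
    by (simp add: algebra_simps)
  ultimately have "(s - r) * (2 + 2 * (1 - s) + 2 * (1 - r) + 8 * ((1 - s) * (1 - r))) = 0"
    by simp
  moreover have "2 + 2 * (1 - s) + 2 * (1 - r) + 8 * ((1 - s) * (1 - r)) > 0"
    using sr by (intro add_pos_nonneg) auto
  ultimately have "s = r" by simp
  then have s: "sin t = sin u" by (simp add: s_def r_def)
  have "cos t = cos u"
  proof (cases "sin u = 1")
    case True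
    then show ?thesis
      using s sin_less_one_if_cos_nonzero[of t] sin_less_one_if_cos_nonzero[of u] by force
  next
    case False
    then show ?thesis
      using eq a denominator_nonzero[of u] by (simp add: omega2_def s)
  qed
  with s show ?thesis by simp
qed

lemma simple_path_omega2:
  assumes a: "a > 0"
  shows "simple_path (revolution (omega2 a))"
  unfolding simple_path_def
proof
  show "path (revolution (omega2 a))"
    using closed_curve_omega2[of a] by (simp add: closed_curve_def valid_path_imp_path)
  show "loop_free (revolution (omega2 a))"
    unfolding loop_free_def
  proof (intro ballI impI)
    fix x y :: real
    assume xy: "x \<in> {0..1}" "y \<in> {0..1}" "revolution (omega2 a) x = revolution (omega2 a) y"
    then obtain n :: int where "2 * pi * x = 2 * pi * y + 2 * pi * n"
      using omega2_eq_imp[OF a] sin_cos_eq_iff unfolding revolution_def by metis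
    then have "2 * pi * x = 2 * pi * (y + n)" by (simp add: algebra_simps)
    then have n: "x = y + n" by simp
    with xy have "\<bar>real_of_int n\<bar> \<le> 1" by auto
    then have "n = 0 \<or> n = 1 \<or> n = - 1" by linarith
    with n xy show "x = y \<or> x = 0 \<and> y = 1 \<or> x = 1 \<and> y = 0" by auto
  qed
qed

lemma smooth_at_if_velocity_nonzero:
  fixes \<gamma> :: "real \<Rightarrow> point"
  assumes deriv: "(\<gamma> has_vector_derivative D) (at t)" and "D \<noteq> 0"
  shows "smooth_at \<gamma> t"
proof -
  have "((\<lambda>s. (1 / (s - t)) *\<^sub>R (\<gamma> s - \<gamma> t)) \<longlongrightarrow> D) (at t)"
  proof -
    have "((\<lambda>s. inverse (s - t) *\<^sub>R (\<gamma> s - \<gamma> t) - D) \<longlongrightarrow> 0) (at t)"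
    proof -
      have "((\<lambda>s. norm ((\<gamma> s - \<gamma> t - (s - t) *\<^sub>R D) /\<^sub>R norm (s - t))) \<longlongrightarrow> 0) (at t)"
        using deriv unfolding has_vector_derivative_def has_derivative_at_within
        by (intro tendsto_norm_zero) (simp add: diff_diff_eq)
      moreover have "\<forall>\<^sub>F s in at t. norm ((\<gamma> s - \<gamma> t - (s - t) *\<^sub>R D) /\<^sub>R norm (s - t)) =
          norm (inverse (s - t) *\<^sub>R (\<gamma> s - \<gamma> t) - D)"
        unfolding eventually_at_filter
      proof (intro always_eventually allI impI)
        fix s :: real assume "s \<noteq> t"
        then have "inverse (s - t) *\<^sub>R (\<gamma> s - \<gamma> t) - D =
            inverse (s - t) *\<^sub>R (\<gamma> s - \<gamma> t - (s - t) *\<^sub>R D)"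
          by (simp add: scaleR_diff_right)
        then show "norm ((\<gamma> s - \<gamma> t - (s - t) *\<^sub>R D) /\<^sub>R norm (s - t)) =
            norm (inverse (s - t) *\<^sub>R (\<gamma> s - \<gamma> t) - D)"
          by simp
      qed
      ultimately have "((\<lambda>s. norm (inverse (s - t) *\<^sub>R (\<gamma> s - \<gamma> t) - D)) \<longlongrightarrow> 0) (at t)"
        by (rule Lim_transform_eventually)
      then show ?thesis by (simp only: tendsto_norm_zero_iff)
    qed
    then show ?thesis by (simp add: LIM_zero_iff inverse_eq_divide)
  qed
  then have lim: "((\<lambda>s. sgn ((1 / (s - t)) *\<^sub>R (\<gamma> s - \<gamma> t))) \<longlongrightarrow> sgn D) (at t)"
    using \<open>D \<noteq> 0\<close> by (rule tendsto_sgn)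
  have "((\<lambda>s. sgn (\<gamma> s - \<gamma> t)) \<longlongrightarrow> sgn D) (at_right t)"
  proof (rule Lim_transform_eventually)
    show "((\<lambda>s. sgn ((1 / (s - t)) *\<^sub>R (\<gamma> s - \<gamma> t))) \<longlongrightarrow> sgn D) (at_right t)"
      using lim by (rule tendsto_within_subset) simp
    show "\<forall>\<^sub>F s in at_right t. sgn ((1 / (s - t)) *\<^sub>R (\<gamma> s - \<gamma> t)) = sgn (\<gamma> s - \<gamma> t)"
      by (auto simp: eventually_at_filter sgn_scaleR)
  qed
  moreover have "((\<lambda>s. sgn (\<gamma> t - \<gamma> s)) \<longlongrightarrow> sgn D) (at_left t)"
  proof (rule Lim_transform_eventually)
    show "((\<lambda>s. sgn ((1 / (s - t)) *\<^sub>R (\<gamma> s - \<gamma> t))) \<longlongrightarrow> sgn D) (at_left t)"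
      using lim by (rule tendsto_within_subset) simp
    show "\<forall>\<^sub>F s in at_left t. sgn ((1 / (s - t)) *\<^sub>R (\<gamma> s - \<gamma> t)) = sgn (\<gamma> t - \<gamma> s)"
      unfolding eventually_at_filter
    proof (intro always_eventually allI impI)
      fix s assume "s \<in> {..<t}"
      have "(1 / (s - t)) *\<^sub>R (\<gamma> s - \<gamma> t) = (1 / (t - s)) *\<^sub>R (\<gamma> t - \<gamma> s)"
      proof -
        have "1 / (s - t) = - (1 / (t - s))" by (simp add: minus_divide_right)
        then have "(1 / (s - t)) *\<^sub>R (\<gamma> s - \<gamma> t) = (1 / (t - s)) *\<^sub>R - (\<gamma> s - \<gamma> t)"
          by (simp only: scaleR_minus_left scaleR_minus_right)
        then show ?thesis by (simp only: minus_diff_eq)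
      qed
      then show "sgn ((1 / (s - t)) *\<^sub>R (\<gamma> s - \<gamma> t)) = sgn (\<gamma> t - \<gamma> s)"
        using \<open>s \<in> {..<t}\<close> by (simp add: sgn_scaleR)
    qed
  qed
  ultimately show ?thesis
    unfolding smooth_at_def tangent_directions_def by blast
qed

lemma velocity2_nonzero:
  assumes a: "a > 0" and "sin t \<noteq> 1"
  shows "velocity2 a t \<noteq> 0"
proof
  assume v: "velocity2 a t = 0"
  have q: "5 - 4 * sin t \<noteq> 0" by (rule denominator_nonzero)
  have "cos t * (7 - 10 * sin t + 4 * (sin t)\<^sup>2) = 0"
    using v a q by (auto simp: velocity2_def zero_prod_def)
  moreover have "7 - 10 * sin t + 4 * (sin t)\<^sup>2 = (2 * sin t - 5 / 2)\<^sup>2 + 3 / 4"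
    by (simp add: power2_eq_square algebra_simps)
  then have "7 - 10 * sin t + 4 * (sin t)\<^sup>2 \<noteq> 0"
    using zero_le_power2[of "2 * sin t - 5 / 2"] by linarith
  ultimately have "cos t = 0" by simp
  then have "(sin t)\<^sup>2 = 1" using sin_cos_squared_add[of t] by simp
  then have "sin t = - 1" using assms(2) by (simp add: power2_eq_1_iff)
  then show False using v a by (simp add: velocity2_def zero_prod_def)
qed

text \<open>
  At the tip the velocity vanishes. The displacement from the tip is, up to a positive factor,
  \<open>(cos t, sin t - 2)\<close>, which tends to the downward direction from both sides, so the curve turns back
  on itself.
\<close>

lemma pointed_at_omega2:
  assumes a: "a > 0"
  shows "pointed_at (omega2 a) (pi / 2)"
proof -
  let ?w = "\<lambda>s. (cos s, sin s - 2) :: point"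
  have disp: "omega2 a s - omega2 a (pi / 2) = (2 * a * (1 - sin s) / (5 - 4 * sin s)) *\<^sub>R ?w s" for s
    using denominator_nonzero[of s] by (simp add: omega2_def field_simps)
  have sgn_eq: "\<forall>\<^sub>F s in at (pi / 2). sgn (?w s) = sgn (omega2 a s - omega2 a (pi / 2))"
    using eventually_cos_nonzero[of "pi / 2"]
  proof eventually_elim
    case (elim s)
    have "2 * a * (1 - sin s) / (5 - 4 * sin s) > 0"
      using a denominator_pos[of s] sin_less_one_if_cos_nonzero[OF elim] by simp
    then show ?case unfolding disp sgn_scaleR by (simp only: sgn_pos scaleR_one)
  qed
  have "isCont ?w (pi / 2)" by (intro continuous_intros)
  then have "(?w \<longlongrightarrow> (0, - 1)) (at (pi / 2))"
    by (drule_tac isContD) simp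
  then have "((\<lambda>s. sgn (?w s)) \<longlongrightarrow> sgn (0, - 1)) (at (pi / 2))"
    by (rule tendsto_sgn) (simp add: zero_prod_def)
  then have "((\<lambda>s. sgn (?w s)) \<longlongrightarrow> (0, - 1)) (at (pi / 2))"
    by (simp add: sgn_div_norm norm_prod_def)
  then have lim: "((\<lambda>s. sgn (omega2 a s - omega2 a (pi / 2))) \<longlongrightarrow> (0, - 1)) (at (pi / 2))"
    using sgn_eq by (rule Lim_transform_eventually)
  have "((\<lambda>s. sgn (omega2 a (pi / 2) - omega2 a s)) \<longlongrightarrow> - (0, - 1)) (at (pi / 2))"
    using tendsto_minus[OF lim] unfolding sgn_minus[symmetric] minus_diff_eq .
  with lim have "tangent_directions (omega2 a) (pi / 2) (0, - 1) (- (0, - 1))"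
    unfolding tangent_directions_def by (blast intro: tendsto_within_subset)
  then show ?thesis
    unfolding pointed_at_def by (intro exI conjI) (assumption, simp)
qed

lemma teardrop_omega2:
  assumes a: "a > 0"
  shows "teardrop (omega2 a)"
  unfolding teardrop_def
proof (intro conjI bexI[of _ "pi / 2"] ballI)
  fix t assume t: "t \<in> {0..<2 * pi} - {pi / 2}"
  have "sin t \<noteq> 1"
  proof
    assume s: "sin t = 1"
    then have "cos t = 0" using sin_less_one_if_cos_nonzero[of t] by force
    then obtain n :: int where n: "t = pi / 2 + 2 * pi * n"
      using s sin_cos_eq_iff[of t "pi / 2"] by auto
    have "0 \<le> t" "t < 2 * pi" using t by auto
    then have "2 * pi * real_of_int n < 2 * pi * 1" and "2 * pi * (- 1) < 2 * pi * real_of_int n"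
      unfolding n using pi_gt_zero by linarith+
    moreover have "2 * pi > 0" by simp
    ultimately have "real_of_int n < 1" and "- 1 < real_of_int n"
      by (blast dest: mult_less_cancel_left_pos[THEN iffD1])+
    then have "n = 0" by linarith
    then show False using n t by simp
  qed
  then show "smooth_at (omega2 a) t"
    using smooth_at_if_velocity_nonzero[OF omega2_has_derivative] velocity2_nonzero[OF a] by blast
qed (use closed_curve_omega2 simple_path_omega2[OF a] pointed_at_omega2[OF a] in auto)

theorem proposition1:
  fixes a :: real
  assumes "a > 0"
  shows "(\<exists>c. Omega1 a ` {0..<2 * pi} = sphere c (a / 3)) \<and>
         encloses_area (Omega1 a) (pi * a\<^sup>2 / 9) \<and>
         teardrop (Omega2 a) \<and>
         encloses_area (Omega2 a) (2 * pi * a\<^sup>2 / 9)"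
  using omega1_image[OF assms] area_omega1[of a] teardrop_omega2[OF assms] area_omega2[of a]
  unfolding Omega1_eq[OF assms] Omega2_eq[OF assms] by blast

end
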